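(* Let $\mathcal{M}$ be a smooth Riemannian manifold, let $\mathcal{H}$ be a reproducing kernel Hilbert space on $\mathcal{M}$ with reproducing kernel $k$, and let $p,q$ be probability densities on $\mathcal{M}$. Then $$\operatorname{mKSD}^{(0)}(p\|q)=\operatorname{MMD}(p\|q).$$
   Context: Densities are with respect to the Riemannian volume element. The zeroth order Stein operator is $\mathcal{A}^{(0)}_qh=h-\mathbb{E}_q[h]$ for $h:\mathcal{M}\to\mathbb{R}$, and $$\operatorname{mKSD}^{(0)}(p\|q)=\sup_{\|h\|_{\mathcal{H}}\le1}\mathbb{E}_p[\mathcal{A}^{(0)}_qh].$$ The maximum mean discrepancy $\operatorname{MMD}(p\|q)\ge0$ is defined by $\operatorname{MMD}(p\|q)^2=\|\mu_p-\mu_q\|_{\mathcal{H}}^2$, where $\mu_p=\mathbb{E}_{x\sim p}[k(x,\cdot)]$ and $\mu_q=\mathbb{E}_{x\sim q}[k(x,\cdot)]$ are the kernel mean embeddings of $p$ and $q$ in $\mathcal{H}$ (assumed to exist, as the definition requires). *)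

theory Defs
  imports "HOL-Analysis.Analysis"
begin

text \<open>The derivatives are taken in the whole space, so this is the right notion only on open \<open>S\<close>.\<close>

fun Ck_on :: "nat \<Rightarrow> 'a::real_normed_vector set \<Rightarrow> ('a \<Rightarrow> 'b::real_normed_vector) \<Rightarrow> bool" where
  "Ck_on 0 S f \<longleftrightarrow> continuous_on S f"
| "Ck_on (Suc k) S f \<longleftrightarrow>
     (\<forall>x\<in>S. f differentiable (at x)) \<and> (\<forall>v. Ck_on k S (\<lambda>x. frechet_derivative f (at x) v))"

definition smooth_on :: "'a::real_normed_vector set \<Rightarrow> ('a \<Rightarrow> 'b::real_normed_vector) \<Rightarrow> bool" where
  "smooth_on S f \<longleftrightarrow> (\<forall>k. Ck_on k S f)"

text \<open>A chart is a pair \<open>(U, \<phi>)\<close> of its domain and its coordinate map; the values of \<open>\<phi>\<close> outside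
  \<open>U\<close> are irrelevant.\<close>

type_synonym ('m, 'n) chart = "'m set \<times> ('m \<Rightarrow> real ^ 'n)"

definition chart_inv :: "('m, 'n) chart \<Rightarrow> real ^ 'n \<Rightarrow> 'm" where
  "chart_inv c = inv_into (fst c) (snd c)"

definition is_chart :: "('m::topological_space, 'n::finite) chart \<Rightarrow> bool" where
  "is_chart c \<longleftrightarrow> open (fst c) \<and> open (snd c ` fst c) \<and>
     homeomorphism (fst c) (snd c ` fst c) (snd c) (chart_inv c)"

definition transition :: "('m, 'n) chart \<Rightarrow> ('m, 'n) chart \<Rightarrow> real ^ 'n \<Rightarrow> real ^ 'n" where
  "transition c d = snd d \<circ> chart_inv c"

text \<open>Hausdorffness and second countability of the manifold are in the sort of \<open>'m\<close>. The atlas need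
  not be maximal.\<close>

definition smooth_atlas ::
  "('m::{t2_space, second_countable_topology}, 'n::finite) chart set \<Rightarrow> bool" where
  "smooth_atlas \<A> \<longleftrightarrow>
     (\<forall>c\<in>\<A>. is_chart c) \<and>
     (\<Union>c\<in>\<A>. fst c) = UNIV \<and>
     (\<forall>c\<in>\<A>. \<forall>d\<in>\<A>. smooth_on (snd c ` (fst c \<inter> fst d)) (transition c d))"

text \<open>A Riemannian metric is given by its coordinate matrices: \<open>g c y\<close> is the Gram matrix of the
  coordinate vector fields of the chart \<open>c\<close> at the point with coordinates \<open>y\<close>. The last clause is
  the transformation law of a covariant 2-tensor.\<close>

definition riemannian_metric ::
  "('m::{t2_space, second_countable_topology}, 'n::finite) chart set \<Rightarrow>
   (('m, 'n) chart \<Rightarrow> real ^ 'n \<Rightarrow> real ^ 'n ^ 'n) \<Rightarrow> bool" where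
  "riemannian_metric \<A> g \<longleftrightarrow>
     (\<forall>c\<in>\<A>. smooth_on (snd c ` fst c) (g c) \<and>
        (\<forall>y\<in>snd c ` fst c. transpose (g c y) = g c y \<and> (\<forall>v. v \<noteq> 0 \<longrightarrow> v \<bullet> (g c y *v v) > 0))) \<and>
     (\<forall>c\<in>\<A>. \<forall>d\<in>\<A>. \<forall>y\<in>snd c ` (fst c \<inter> fst d).
        g c y = transpose (jacobian (transition c d) (at y)) ** g d (transition c d y)
                  ** jacobian (transition c d) (at y))"

definition riemannian_manifold ::
  "('m::{t2_space, second_countable_topology}, 'n::finite) chart set \<Rightarrow>
   (('m, 'n) chart \<Rightarrow> real ^ 'n \<Rightarrow> real ^ 'n ^ 'n) \<Rightarrow> bool" where
  "riemannian_manifold \<A> g \<longleftrightarrow> smooth_atlas \<A> \<and> riemannian_metric \<A> g"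

text \<open>The Riemannian volume is the Borel measure given by \<open>sqrt (det g) dy\<close> in every chart; as
  countably many charts cover the manifold, this determines it uniquely.\<close>

definition riemannian_volume ::
  "('m::{t2_space, second_countable_topology}, 'n::finite) chart set \<Rightarrow>
   (('m, 'n) chart \<Rightarrow> real ^ 'n \<Rightarrow> real ^ 'n ^ 'n) \<Rightarrow> 'm measure \<Rightarrow> bool" where
  "riemannian_volume \<A> g vol \<longleftrightarrow> sets vol = sets borel \<and>
     (\<forall>c\<in>\<A>. \<forall>B\<in>sets borel. B \<subseteq> fst c \<longrightarrow>
        emeasure vol B = (\<integral>\<^sup>+ y\<in>snd c ` B. ennreal (sqrt (det (g c y))) \<partial>lborel))"

definition probability_density :: "'m measure \<Rightarrow> ('m \<Rightarrow> real) \<Rightarrow> bool" where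
  "probability_density vol p \<longleftrightarrow>
     p \<in> borel_measurable vol \<and> (\<forall>x. 0 \<le> p x) \<and> (\<integral>\<^sup>+ x. ennreal (p x) \<partial>vol) = 1"

definition law :: "'m measure \<Rightarrow> ('m \<Rightarrow> real) \<Rightarrow> 'm measure" where
  "law vol p = density vol (\<lambda>x. ennreal (p x))"

definition expect :: "'m measure \<Rightarrow> ('m \<Rightarrow> real) \<Rightarrow> ('m \<Rightarrow> real) \<Rightarrow> real" where
  "expect vol p f = (LINT x|law vol p. f x)"

text \<open>A Hilbert space of real functions on \<open>'m\<close> is a Hilbert space \<open>'h\<close> with an injective linear map
  \<open>fn\<close> taking each element to the function that it is. It has reproducing kernel \<open>k\<close> if every
  section \<open>k x\<close> belongs to it and represents evaluation at \<open>x\<close>.\<close>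

definition reproducing_kernel_hilbert_space ::
  "('h::{real_inner, complete_space} \<Rightarrow> 'm \<Rightarrow> real) \<Rightarrow> ('m \<Rightarrow> 'm \<Rightarrow> real) \<Rightarrow> bool" where
  "reproducing_kernel_hilbert_space fn k \<longleftrightarrow>
     inj fn \<and> (\<forall>x. linear (\<lambda>h. fn h x)) \<and>
     (\<forall>x. \<exists>s. fn s = k x \<and> (\<forall>h. fn h x = h \<bullet> s))"

definition kernel_section :: "('h \<Rightarrow> 'm \<Rightarrow> real) \<Rightarrow> ('m \<Rightarrow> 'm \<Rightarrow> real) \<Rightarrow> 'm \<Rightarrow> 'h" where
  "kernel_section fn k x = (THE s. fn s = k x)"

text \<open>The kernel mean embedding is the expectation of the Hilbert-space valued random element
  \<open>x \<mapsto> k(x, \<cdot>)\<close>, in the weak (Pettis) sense: the Bochner integral of the library needs a separable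
  space, and \<open>'h\<close> need not be separable. Where the Bochner integral exists, the two agree.\<close>

definition has_weak_expectation ::
  "'m measure \<Rightarrow> ('m \<Rightarrow> 'h::real_inner) \<Rightarrow> 'h \<Rightarrow> bool" where
  "has_weak_expectation P \<xi> m \<longleftrightarrow>
     (\<forall>h. integrable P (\<lambda>x. \<xi> x \<bullet> h) \<and> (LINT x|P. \<xi> x \<bullet> h) = m \<bullet> h)"

definition mean_embedding_exists ::
  "'m measure \<Rightarrow> ('h::real_inner \<Rightarrow> 'm \<Rightarrow> real) \<Rightarrow> ('m \<Rightarrow> 'm \<Rightarrow> real) \<Rightarrow> ('m \<Rightarrow> real) \<Rightarrow> bool" where
  "mean_embedding_exists vol fn k p \<longleftrightarrow>
     (\<exists>m. has_weak_expectation (law vol p) (kernel_section fn k) m)"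

definition mean_embedding ::
  "'m measure \<Rightarrow> ('h::real_inner \<Rightarrow> 'm \<Rightarrow> real) \<Rightarrow> ('m \<Rightarrow> 'm \<Rightarrow> real) \<Rightarrow> ('m \<Rightarrow> real) \<Rightarrow> 'h" where
  "mean_embedding vol fn k p =
     (THE m. has_weak_expectation (law vol p) (kernel_section fn k) m)"

definition MMD ::
  "'m measure \<Rightarrow> ('h::real_inner \<Rightarrow> 'm \<Rightarrow> real) \<Rightarrow> ('m \<Rightarrow> 'm \<Rightarrow> real) \<Rightarrow>
   ('m \<Rightarrow> real) \<Rightarrow> ('m \<Rightarrow> real) \<Rightarrow> real" where
  "MMD vol fn k p q = sqrt ((norm (mean_embedding vol fn k p - mean_embedding vol fn k q))\<^sup>2)"

definition stein0 :: "'m measure \<Rightarrow> ('m \<Rightarrow> real) \<Rightarrow> ('m \<Rightarrow> real) \<Rightarrow> 'm \<Rightarrow> real" where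
  "stein0 vol q h = (\<lambda>x. h x - expect vol q h)"

text \<open>The supremum is taken in the extended reals, so that its finiteness is not presupposed.\<close>

definition mKSD0 ::
  "'m measure \<Rightarrow> ('h::real_normed_vector \<Rightarrow> 'm \<Rightarrow> real) \<Rightarrow> ('m \<Rightarrow> real) \<Rightarrow> ('m \<Rightarrow> real) \<Rightarrow> ereal" where
  "mKSD0 vol fn p q = (SUP h\<in>{h. norm h \<le> 1}. ereal (expect vol p (stein0 vol q (fn h))))"

end

theory Submission
  imports Defs "HOL-Probability.Probability_Measure"
begin

text \<open>Write \<mu>p and \<mu>q for the mean embeddings. The reproducing property turns the
  expectation of \<open>fn h\<close> into the inner product of \<open>h\<close> with the mean
  embedding (\<open>expect_eq_mean_embedding_inner\<close>). Hence the expectation under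
  \<open>p\<close> of the Stein operator applied to \<open>fn h\<close> is the value at
  \<open>h\<close> of the linear functional represented by \<mu>p - \<mu>q
  (\<open>expect_stein0\<close>). Its supremum over the unit ball is the norm of the representer
  (\<open>SUP_inner_unit_ball\<close>), which is the MMD.\<close>

lemma SUP_inner_unit_ball:
  fixes d :: "'a::real_inner"
  shows "(SUP h\<in>{h. norm h \<le> 1}. ereal (d \<bullet> h)) = ereal (norm d)"
proof (rule antisym)
  show "(SUP h\<in>{h. norm h \<le> 1}. ereal (d \<bullet> h)) \<le> ereal (norm d)"
  proof (rule SUP_least)
    fix h :: 'a assume "h \<in> {h. norm h \<le> 1}"
    then have "norm d * norm h \<le> norm d"
      by (simp add: mult_left_le)
    then show "ereal (d \<bullet> h) \<le> ereal (norm d)"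
      using norm_cauchy_schwarz[of d h] by simp
  qed
  \<comment> \<open>The equality case of Cauchy-Schwarz: \<open>sgn d\<close> is \<open>d\<close>
    scaled to norm 1. If \<open>d = 0\<close>, it is \<open>0\<close>, still a point of the
    ball.\<close>
  have "d \<bullet> sgn d = norm d"
    by (cases "d = 0") (simp_all add: sgn_div_norm dot_square_norm power2_eq_square)
  moreover have "sgn d \<in> {h. norm h \<le> 1}"
    by (simp add: norm_sgn)
  ultimately show "ereal (norm d) \<le> (SUP h\<in>{h. norm h \<le> 1}. ereal (d \<bullet> h))"
    using SUP_upper[of "sgn d" "{h. norm h \<le> 1}" "\<lambda>h. ereal (d \<bullet> h)"] by simp
qed

lemma prob_space_law:
  assumes "probability_density vol p"
  shows "prob_space (law vol p)"
proof (rule prob_spaceI)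
  have "(\<lambda>x. ennreal (p x)) \<in> borel_measurable vol"
    using assms by (simp add: probability_density_def)
  then have "emeasure (law vol p) (space vol) = (\<integral>\<^sup>+ x. ennreal (p x) * indicator (space vol) x \<partial>vol)"
    unfolding law_def by (rule emeasure_density) simp
  also have "\<dots> = (\<integral>\<^sup>+ x. ennreal (p x) \<partial>vol)"
    by (rule nn_integral_cong) simp
  finally show "emeasure (law vol p) (space (law vol p)) = 1"
    using assms by (simp add: probability_density_def law_def)
qed

text \<open>The operator subtracts the constant \<open>expect vol q h\<close>, which integrates to
  itself because the law of \<open>p\<close> has total mass 1.\<close>

lemma expect_stein0:
  assumes "probability_density vol p" and "integrable (law vol p) h"
  shows "expect vol p (stein0 vol q h) = expect vol p h - expect vol q h"
proof -
  interpret prob_space "law vol p"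
    using assms(1) by (rule prob_space_law)
  show ?thesis
    using assms(2) by (simp add: expect_def[of vol p] stein0_def prob_space)
qed

lemma has_weak_expectation_unique:
  assumes "has_weak_expectation P \<xi> m" and "has_weak_expectation P \<xi> m'"
  shows "m = m'"
proof -
  have "m \<bullet> h = m' \<bullet> h" for h
    using assms by (simp add: has_weak_expectation_def)
  then show ?thesis
    using vector_eq_rdot by blast
qed

text \<open>A vector is determined by its inner products with all \<open>h\<close>. This makes the
  \<open>THE\<close> in \<open>mean_embedding\<close> well defined.\<close>

lemma has_weak_expectation_mean_embedding:
  assumes "mean_embedding_exists vol fn k p"
  shows "has_weak_expectation (law vol p) (kernel_section fn k) (mean_embedding vol fn k p)"
proof -
  have "\<exists>!m. has_weak_expectation (law vol p) (kernel_section fn k) m"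
    using assms has_weak_expectation_unique unfolding mean_embedding_exists_def by blast
  then show ?thesis
    unfolding mean_embedding_def by (rule theI')
qed

text \<open>Injectivity of \<open>fn\<close> forces the \<open>THE\<close> in
  \<open>kernel_section\<close> to be the element that represents evaluation at
  \<open>x\<close>.\<close>

lemma kernel_section_inner:
  assumes "reproducing_kernel_hilbert_space fn k"
  shows "kernel_section fn k x \<bullet> h = fn h x"
proof -
  obtain s where s: "fn s = k x" "\<And>h. fn h x = h \<bullet> s"
    using assms unfolding reproducing_kernel_hilbert_space_def by blast
  have "inj fn"
    using assms by (simp add: reproducing_kernel_hilbert_space_def)
  then have "kernel_section fn k x = s"
    unfolding kernel_section_def by (simp add: s(1)[symmetric] inj_eq)
  then show ?thesis
    by (simp add: s(2) inner_commute)
qed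

text \<open>Testing the weak expectation against \<open>h\<close> integrates
  \<open>kernel_section fn k x \<bullet> h\<close>, which is \<open>fn h x\<close> by the
  reproducing property.\<close>

lemma expect_eq_mean_embedding_inner:
  assumes "reproducing_kernel_hilbert_space fn k" and "mean_embedding_exists vol fn k p"
  shows "integrable (law vol p) (fn h)"
    and "expect vol p (fn h) = mean_embedding vol fn k p \<bullet> h"
  using has_weak_expectation_mean_embedding[OF assms(2)]
  by (simp_all add: has_weak_expectation_def kernel_section_inner[OF assms(1)] expect_def)

theorem theorem4:
  fixes \<A> :: "('m::{t2_space, second_countable_topology}, 'n::finite) chart set"
    and g :: "('m, 'n) chart \<Rightarrow> real ^ 'n \<Rightarrow> real ^ 'n ^ 'n"
    and vol :: "'m measure"
    and fn :: "'h::{real_inner, complete_space} \<Rightarrow> 'm \<Rightarrow> real"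
    and k :: "'m \<Rightarrow> 'm \<Rightarrow> real"
    and p q :: "'m \<Rightarrow> real"
  assumes "riemannian_manifold \<A> g"
    and "riemannian_volume \<A> g vol"
    and "reproducing_kernel_hilbert_space fn k"
    and "probability_density vol p"
    and "probability_density vol q"
    and "mean_embedding_exists vol fn k p"
    and "mean_embedding_exists vol fn k q"
  shows "mKSD0 vol fn p q = ereal (MMD vol fn k p q)"
proof -
  have "expect vol p (stein0 vol q (fn h)) =
      (mean_embedding vol fn k p - mean_embedding vol fn k q) \<bullet> h" for h
    using assms by (simp add: expect_stein0 expect_eq_mean_embedding_inner inner_diff_left)
  then show ?thesis
    by (simp add: mKSD0_def MMD_def SUP_inner_unit_ball)
qed

end
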